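(* Let $p>1$, $A>0$ and $\sigma\ge 1$ be real numbers, and let $(f,g)\in C_0^2(\mathbf{R})\times C_0^1(\mathbf{R})$ be real-valued functions satisfying $\operatorname{supp}(f,g)\subset\{x\in\mathbf{R}: |x|\le\sigma\}$. Assume that either $$f(x)\ge 0,\ g(x)\ge 0 \ \text{ for all } x\in\mathbf{R},\ \text{ and } f\not\equiv 0,$$ or $$f(x)\ge 0,\ g(x)\ge 0 \ \text{ for all } x\in\mathbf{R},\ \text{ and } g\not\equiv 0.$$ Then there exist a constant $\varepsilon_0=\varepsilon_0(f,g,p,A,\sigma)>0$ and a constant $C>0$ independent of $\varepsilon$ such that, for every $\varepsilon$ with $0<\varepsilon\le\varepsilon_0$ and every $T$ satisfying $$T>C\varepsilon^{-(p-1)},$$ there exists no classical solution $v=v(x,t)$ in the time interval $[0,T]$ of the initial value problem $$\begin{cases} v_{tt}-v_{xx}=A|v_x|^{p-2}v_x\,v_{xx} & \text{in } \mathbf{R}\times(0,T),\\ v(x,0)=\varepsilon f(x),\quad v_t(x,0)=\varepsilon g(x), & x\in\mathbf{R}.\end{cases}$$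
   Context: $C_0^k(\mathbf{R})$ denotes the $C^k$ functions on $\mathbf{R}$ with compact support, and $\operatorname{supp}(f,g)\subset K$ means that both $f$ and $g$ vanish outside $K$. The unknown $v$ is a real-valued scalar function, and subscripts denote partial derivatives. A classical solution in the time interval $[0,T]$ is a function $v\in C^2(\mathbf{R}\times[0,T])$ satisfying the equation and the initial conditions pointwise. The expression $|s|^{p-2}s$ is understood as $0$ when $s=0$. The constant $C$ may depend on $f,g,p,A,\sigma$ but not on $\varepsilon$ or $T$. *)

theory Defs
  imports "HOL-Analysis.Analysis"
begin

definition C0k :: "nat \<Rightarrow> (real \<Rightarrow> real) \<Rightarrow> bool" where
  "C0k k f \<longleftrightarrow>
     (\<forall>j<k. \<forall>x. ((deriv ^^ j) f) differentiable (at x)) \<and>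
     (\<forall>j\<le>k. continuous_on UNIV ((deriv ^^ j) f)) \<and>
     compact (closure {x. f x \<noteq> 0})"

definition strip :: "real \<Rightarrow> (real \<times> real) set" where
  "strip T = UNIV \<times> {0..T}"

definition dx :: "(real \<times> real \<Rightarrow> real) \<Rightarrow> real \<times> real \<Rightarrow> real" where
  "dx u = (\<lambda>(x, t). deriv (\<lambda>y. u (y, t)) x)"

text \<open>The time derivative is taken within \<open>{0..T}\<close>: two-sided for \<open>0 < t < T\<close>, one-sided at the
  end points. Values of \<open>u\<close> outside the strip therefore play no role.\<close>

definition dt :: "real \<Rightarrow> (real \<times> real \<Rightarrow> real) \<Rightarrow> real \<times> real \<Rightarrow> real" where
  "dt T u = (\<lambda>(x, t). vector_derivative (\<lambda>s. u (x, s)) (at t within {0..T}))"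

definition C1_strip :: "real \<Rightarrow> (real \<times> real \<Rightarrow> real) \<Rightarrow> bool" where
  "C1_strip T u \<longleftrightarrow>
     (\<forall>(x, t) \<in> strip T. (\<lambda>y. u (y, t)) differentiable (at x) \<and>
                        (\<lambda>s. u (x, s)) differentiable (at t within {0..T})) \<and>
     continuous_on (strip T) u \<and>
     continuous_on (strip T) (dx u) \<and>
     continuous_on (strip T) (dt T u)"

definition C2_strip :: "real \<Rightarrow> (real \<times> real \<Rightarrow> real) \<Rightarrow> bool" where
  "C2_strip T u \<longleftrightarrow> C1_strip T u \<and> C1_strip T (dx u) \<and> C1_strip T (dt T u)"

text \<open>The factor \<open>\<bar>s\<bar> powr (p - 2) * s\<close> is \<open>0\<close> at \<open>s = 0\<close>, also for \<open>p \<le> 2\<close>.\<close>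

definition classical_solution ::
  "real \<Rightarrow> real \<Rightarrow> (real \<Rightarrow> real) \<Rightarrow> (real \<Rightarrow> real) \<Rightarrow> real \<Rightarrow> (real \<times> real \<Rightarrow> real) \<Rightarrow> bool" where
  "classical_solution p A v0 v1 T v \<longleftrightarrow>
     C2_strip T v \<and>
     (\<forall>x. \<forall>t \<in> {0<..<T}.
        dt T (dt T v) (x, t) - dx (dx v) (x, t) =
        A * (\<bar>dx v (x, t)\<bar> powr (p - 2) * dx v (x, t)) * dx (dx v) (x, t)) \<and>
     (\<forall>x. v (x, 0) = v0 x) \<and>
     (\<forall>x. dt T v (x, 0) = v1 x)"

end

theory Submission
  imports Defs
begin

text \<open>While the slope \<open>v\<^sub>x\<close> is small, the Riemann invariants \<open>v\<^sub>t \<plusminus> h (v\<^sub>x)\<close>, with \<open>h' = sqrt (1 + A \<bar>s\<bar>\<^sup>p\<^sup>-\<^sup>2 s)\<close>,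
  are transported along characteristics. The maximum principle for them keeps \<open>v\<^sub>x\<close> and \<open>v\<^sub>t\<close> of size
  \<open>O(\<epsilon>)\<close> for as long as the classical solution exists, and shows that \<open>v\<close> vanishes for \<open>x + t \<le> - \<sigma>\<close>.
  On the strip \<open>\<bar>x + t\<bar> \<le> \<sigma>\<close> moving to the left, a weighted mean \<open>Y\<close> of \<open>v\<close> and \<open>v\<^sub>t - v\<^sub>x\<close>
  satisfies \<open>Y' = (A / p) \<integral> \<bar>v\<^sub>x\<bar>\<^sup>p\<close>, so that \<open>Y \<ge> Y 0 = c\<^sub>0 \<epsilon>\<close>. Adding a multiple \<open>\<mu>\<close>, of order
  \<open>\<epsilon>\<^sup>p\<^sup>-\<^sup>1\<close>, of a weighted mean of \<open>v\<close>, one obtains a quantity whose derivative is at least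
  \<open>\<mu> c\<^sub>0 \<epsilon> / 2\<close> but which stays \<open>O(\<epsilon>)\<close>; hence \<open>T = O(\<epsilon>\<^sup>1\<^sup>-\<^sup>p)\<close>.\<close>

section \<open>Propagation speed\<close>

lemma abs_powr_times_self: "\<bar>s\<bar> powr (p - 2) * s = sgn s * \<bar>s\<bar> powr (p - 1)" for p s :: real
  using powr_mult_base'[of "\<bar>s\<bar>" "p - 2"] by (auto simp: sgn_real_def abs_if mult.commute)

text \<open>At \<open>0\<close> the difference quotient has absolute value
  \<open>\<bar>h\<bar> powr (p - 1)\<close>, which tends to \<open>0\<close> because
  \<open>p > 1\<close>; elsewhere the function is \<open>(x\<^sup>2) powr (p / 2)\<close>, which is
  smooth there.\<close>

lemma DERIV_abs_powr:
  fixes p x :: real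
  assumes "1 < p"
  shows "((\<lambda>x. \<bar>x\<bar> powr p) has_real_derivative p * (\<bar>x\<bar> powr (p - 2) * x)) (at x)"
proof (cases "x = 0")
  case True
  have "((\<lambda>h. \<bar>h\<bar> powr (p - 1)) \<longlongrightarrow> 0) (at 0)"
    using assms by (intro tendsto_eq_intros | simp)+
  then have "((\<lambda>h. \<bar>(\<bar>h\<bar> powr p) / h\<bar>) \<longlongrightarrow> 0) (at (0::real))"
    by (rule Lim_transform_eventually)
       (auto simp: eventually_at_filter abs_mult powr_diff divide_simps)
  then have "((\<lambda>h. (\<bar>h\<bar> powr p) / h) \<longlongrightarrow> 0) (at (0::real))"
    by (rule tendsto_rabs_zero_cancel)
  then show ?thesis using True by (simp add: DERIV_def)
next
  case False
  have square: "\<bar>y\<bar> powr q = (y\<^sup>2) powr (q / 2)" for y q :: real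
    using powr_powr[of "\<bar>y\<bar>" 2 "q / 2"] by (cases "y = 0") auto
  have "((\<lambda>x. (x\<^sup>2) powr (p / 2)) has_real_derivative p / 2 * (x\<^sup>2) powr (p / 2 - 1) * (2 * x)) (at x)"
    using False by (auto intro!: derivative_eq_intros)
  moreover have "p / 2 - 1 = (p - 2) / 2" by simp
  ultimately show ?thesis by (simp only: square) (simp add: mult_ac)
qed

text \<open>For \<open>p < 2\<close> the factor \<open>\<bar>s\<bar> powr (p - 2)\<close> is
  unbounded near \<open>0\<close>, but the product has absolute value
  \<open>\<bar>s\<bar> powr (p - 1)\<close> there.\<close>

lemma isCont_abs_powr_times_self:
  fixes p x :: real
  assumes "1 < p"
  shows "isCont (\<lambda>s. \<bar>s\<bar> powr (p - 2) * s) x"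
proof (cases "x = 0")
  case True
  have "((\<lambda>h. \<bar>h\<bar> powr (p - 1)) \<longlongrightarrow> 0) (at (0::real))"
    using assms by (intro tendsto_eq_intros | simp)+
  then have "((\<lambda>s. \<bar>sgn s * \<bar>s\<bar> powr (p - 1)\<bar>) \<longlongrightarrow> 0) (at (0::real))"
    by (rule Lim_transform_eventually) (auto simp: eventually_at_filter abs_mult)
  then show ?thesis using True
    by (auto simp: isCont_def abs_powr_times_self dest: tendsto_rabs_zero_cancel)
qed (intro continuous_intros, auto)

text \<open>The cut-off at \<open>1/4\<close> makes the speed real and positive for every slope.\<close>

definition speed :: "real \<Rightarrow> real \<Rightarrow> real \<Rightarrow> real" where
  "speed p A s = sqrt (max (1/4) (1 + A * (\<bar>s\<bar> powr (p - 2) * s)))"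

lemma speed_ge_half: "1/2 \<le> speed p A s"
proof -
  have "sqrt (1/4) \<le> speed p A s"
    unfolding speed_def by (intro real_sqrt_le_mono) simp
  then show ?thesis by (simp add: real_sqrt_divide)
qed

lemma speed_antiderivative:
  assumes "1 < p"
  obtains h where "h 0 = 0" "\<And>s. (h has_real_derivative speed p A s) (at s)"
proof -
  have "isCont (speed p A) s" for s
    unfolding speed_def[abs_def]
    by (intro continuous_intros isCont_abs_powr_times_self assms)
  then obtain F where "\<forall>s. (F has_vector_derivative speed p A s) (at s)"
    using einterval_antiderivative[of "-\<infinity>" \<infinity> "speed p A"] by auto
  then have "((\<lambda>s. F s - F 0) has_real_derivative speed p A s) (at s)" for s
    by (auto intro!: derivative_eq_intros simp: has_real_derivative_iff_has_vector_derivative)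
  then show ?thesis using that[of "\<lambda>s. F s - F 0"] by auto
qed

text \<open>At slope \<open>0\<close> the radicand is \<open>1\<close>, so by continuity it stays
  strictly between \<open>1/4\<close> and \<open>a\<^sup>2\<close> nearby: the cut-off is inactive
  there. The threshold \<open>a\<close> is left free because the a priori bounds take
  \<open>a = 2\<close>, whereas the front takes values arbitrarily close to
  \<open>1\<close>.\<close>

lemma speed_near_zero:
  assumes "1 < p" "1 < a"
  obtains \<eta> where "0 < \<eta>"
    "\<And>s. \<bar>s\<bar> \<le> \<eta> \<Longrightarrow> speed p A s \<le> a"
    "\<And>s. \<bar>s\<bar> \<le> \<eta> \<Longrightarrow> (speed p A s)\<^sup>2 = 1 + A * (\<bar>s\<bar> powr (p - 2) * s)"
proof -
  let ?c = "\<lambda>s. 1 + A * (\<bar>s\<bar> powr (p - 2) * s)"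
  have "isCont ?c 0"
    by (intro continuous_intros isCont_abs_powr_times_self assms)
  then have c: "(?c \<longlongrightarrow> ?c 0) (nhds 0)"
    unfolding isCont_def by (subst (asm) tendsto_at_iff_tendsto_nhds)
  have "\<forall>\<^sub>F s in nhds 0. ?c s < a\<^sup>2" "\<forall>\<^sub>F s in nhds 0. 1/4 < ?c s"
    using order_tendstoD(2)[OF c, of "a\<^sup>2"] order_tendstoD(1)[OF c, of "1/4"] assms
    by (simp_all add: one_less_power)
  then have "\<forall>\<^sub>F s in nhds 0. 1/4 < ?c s \<and> ?c s < a\<^sup>2"
    by eventually_elim auto
  then obtain d where d: "0 < d" "\<And>s. \<bar>s\<bar> < d \<Longrightarrow> 1/4 < ?c s \<and> ?c s < a\<^sup>2"
    unfolding eventually_nhds_metric dist_real_def by auto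
  show ?thesis
  proof (rule that[of "d/2"])
    fix s :: real assume "\<bar>s\<bar> \<le> d/2"
    then have s: "1/4 < ?c s \<and> ?c s < a\<^sup>2" using d by (intro d(2)) simp
    then show "speed p A s \<le> a" unfolding speed_def using assms by (intro real_le_lsqrt) auto
    show "(speed p A s)\<^sup>2 = ?c s" unfolding speed_def using s by (auto simp: max_def)
  qed (use d in auto)
qed

section \<open>Maximum principle\<close>

lemma increment_ge:
  fixes u :: "real \<Rightarrow> real"
  assumes "a \<le> b"
    and "\<And>x. x \<in> {a..b} \<Longrightarrow> (u has_real_derivative u' x) (at x within {a..b})"
    and "\<And>x. x \<in> {a..b} \<Longrightarrow> k \<le> u' x"
  shows "k * (b - a) \<le> u b - u a"
proof (cases "a = b")
  case False
  then obtain x where "x \<in> {a<..<b}" "u b - u a = u' x * (b - a)"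
    using mvt_simple[of a b u "\<lambda>x y. u' x * y"] assms(1,2) by (auto simp: has_field_derivative_def)
  then show ?thesis using assms(1,3) by (auto intro!: mult_right_mono)
qed auto

text \<open>The chain rule along straight lines, relative to sets because backward rays and vertical
  segments end on the boundary of the strip.\<close>

lemma has_derivative_line:
  fixes u :: "real \<times> real \<Rightarrow> real"
  assumes "(u has_derivative (\<lambda>d. p * fst d + q * snd d)) (at (x + b * s, t + k * s) within X)"
    and "\<And>r. r \<in> U \<Longrightarrow> (x + b * r, t + k * r) \<in> X"
  shows "((\<lambda>r. u (x + b * r, t + k * r)) has_real_derivative p * b + q * k) (at s within U)"
proof -
  have "((\<lambda>r. u (x + b * r, t + k * r)) has_derivative (\<lambda>d. p * fst (b * d, k * d) + q * snd (b * d, k * d)))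
    (at s within U)"
    by (rule has_derivative_in_compose[of "\<lambda>r. (x + b * r, t + k * r)", where g = u])
       (auto intro!: derivative_eq_intros has_derivative_subset[OF assms(1)] assms(2))
  then show ?thesis
    unfolding has_field_derivative_def by (rule has_derivative_eq_rhs) (auto simp: fun_eq_iff algebra_simps)
qed

text \<open>A domain of dependence over the base from \<open>l\<close> to \<open>q\<close> for
  speeds up to \<open>a\<close>: its sides move inwards at speed \<open>a\<close>, so it degenerates
  to a triangle or less once they meet.\<close>

definition trapezoid :: "real \<Rightarrow> real \<Rightarrow> real \<Rightarrow> real \<Rightarrow> (real \<times> real) set" where
  "trapezoid l q a \<tau> = {(x, t). 0 \<le> t \<and> t \<le> \<tau> \<and> l + a * t \<le> x \<and> x \<le> q - a * t}"

lemma compact_trapezoid: "compact (trapezoid l q a \<tau>)" (is "compact ?K")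
proof -
  have "?K = (\<lambda>z. snd z) -` {0..} \<inter> ((\<lambda>z. snd z) -` {..\<tau>}
      \<inter> ((\<lambda>z. fst z - a * snd z) -` {l..} \<inter> (\<lambda>z. fst z + a * snd z) -` {..q}))"
    by (auto simp: trapezoid_def algebra_simps)
  also have "closed \<dots>"
    by (intro closed_Int closed_vimage continuous_intros closed_atLeast closed_atMost)
  finally have "closed ?K" .
  moreover have "bounded ?K"
  proof (rule bounded_subset)
    show "?K \<subseteq> {l - \<bar>a\<bar> * \<bar>\<tau>\<bar>..q + \<bar>a\<bar> * \<bar>\<tau>\<bar>} \<times> {0..\<tau>}"
    proof (rule subrelI)
      fix x t assume "(x, t) \<in> ?K"
      then have *: "0 \<le> t" "t \<le> \<tau>" "l + a * t \<le> x" "x \<le> q - a * t" by (auto simp: trapezoid_def)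
      have "\<bar>a * t\<bar> \<le> \<bar>a\<bar> * \<bar>\<tau>\<bar>"
        unfolding abs_mult using * by (intro mult_left_mono) auto
      then show "(x, t) \<in> {l - \<bar>a\<bar> * \<bar>\<tau>\<bar>..q + \<bar>a\<bar> * \<bar>\<tau>\<bar>} \<times> {0..\<tau>}" using * by auto
    qed
    show "bounded ({l - \<bar>a\<bar> * \<bar>\<tau>\<bar>..q + \<bar>a\<bar> * \<bar>\<tau>\<bar>} \<times> {0..\<tau>})"
      by (intro bounded_Times bounded_closed_interval)
  qed
  ultimately show ?thesis by (simp add: compact_eq_bounded_closed)
qed

text \<open>Along the backward rays \<open>r - \<kappa> * t\<close> increases for every \<open>\<kappa> > 0\<close>, and the rays stay in
  the trapezoid, so a maximum can only be attained at \<open>t = 0\<close>.\<close>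

lemma max_principle_trapezoid:
  fixes r :: "real \<times> real \<Rightarrow> real"
  assumes cont: "continuous_on (trapezoid l q a \<tau>) r"
    and ray: "\<And>x t. (x, t) \<in> trapezoid l q a \<tau> \<Longrightarrow> 0 < t \<Longrightarrow>
      \<exists>b. \<bar>b\<bar> \<le> a \<and> ((\<lambda>s. r (x + b * s, t - s)) has_real_derivative 0) (at 0 within {0..t})"
    and initial: "\<And>x. l \<le> x \<Longrightarrow> x \<le> q \<Longrightarrow> r (x, 0) \<le> m"
    and z: "(x, t) \<in> trapezoid l q a \<tau>"
  shows "r (x, t) \<le> m"
proof -
  let ?K = "trapezoid l q a \<tau>"
  have bound: "r (x, t) \<le> m + \<kappa> * \<tau>" if \<kappa>: "0 < \<kappa>" for \<kappa>
  proof -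
    obtain x1 t1 where z1: "(x1, t1) \<in> ?K"
      and max: "\<And>y s. (y, s) \<in> ?K \<Longrightarrow> r (y, s) - \<kappa> * s \<le> r (x1, t1) - \<kappa> * t1"
      using continuous_attains_sup[OF compact_trapezoid, of l q a \<tau> "\<lambda>z. r z - \<kappa> * snd z"] z cont
      by (fastforce intro!: continuous_intros)
    have "t1 = 0"
    proof (rule ccontr)
      assume "t1 \<noteq> 0"
      then have t1: "0 < t1" using z1 by (auto simp: trapezoid_def)
      obtain b where b: "\<bar>b\<bar> \<le> a"
        and D: "((\<lambda>s. r (x1 + b * s, t1 - s)) has_real_derivative 0) (at 0 within {0..t1})"
        using ray[OF z1 t1] by auto
      have "((\<lambda>s. r (x1 + b * s, t1 - s) - \<kappa> * (t1 - s)) has_real_derivative \<kappa>) (at 0 within {0..t1})"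
        by (rule derivative_eq_intros D refl | simp)+
      from has_real_derivative_pos_inc_right[OF this \<kappa>] obtain d where d: "0 < d"
        "\<And>s. 0 < s \<Longrightarrow> s \<le> t1 \<Longrightarrow> s < d \<Longrightarrow>
          r (x1, t1) - \<kappa> * t1 < r (x1 + b * s, t1 - s) - \<kappa> * (t1 - s)"
        by auto
      define s where "s = min t1 (d/2)"
      have s: "0 < s" "s \<le> t1" "s < d" using d t1 by (auto simp: s_def)
      have "\<bar>b * s\<bar> \<le> a * s" unfolding abs_mult using s b by (auto intro!: mult_right_mono)
      then have "(x1 + b * s, t1 - s) \<in> ?K"
        using z1 s by (auto simp: trapezoid_def algebra_simps)
      from max[OF this] d(2)[OF s] show False by linarith
    qed
    then have "r (x1, t1) \<le> m" using z1 initial by (auto simp: trapezoid_def)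
    then have "r (x, t) \<le> m + \<kappa> * t" using max[OF z] \<open>t1 = 0\<close> by simp
    also have "\<dots> \<le> m + \<kappa> * \<tau>" using z \<kappa> by (auto simp: trapezoid_def)
    finally show ?thesis .
  qed
  have \<tau>: "0 \<le> \<tau>" using z by (auto simp: trapezoid_def)
  \<comment> \<open>Here \<open>\<kappa>\<close> tends to \<open>0\<close>; the denominator
    \<open>\<tau> + 1\<close> also covers \<open>\<tau> = 0\<close>.\<close>
  show ?thesis
  proof (rule field_le_epsilon)
    fix e :: real assume e: "0 < e"
    have "e / (\<tau> + 1) * \<tau> \<le> e" using e \<tau> by (simp add: field_simps)
    then show "r (x, t) \<le> m + e" using bound[of "e / (\<tau> + 1)"] e \<tau> by simp
  qed
qed

section \<open>Riemann invariants\<close>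

text \<open>The shared \<open>S\<close> encodes the symmetry of the mixed partials. The equation is
  demanded on the closed strip, including both end times, where it follows by continuity.\<close>

locale quasilinear_wave =
  fixes p A T :: real and v P Q R S W :: "real \<times> real \<Rightarrow> real"
  assumes p: "1 < p" and A: "0 < A"
    and dv: "z \<in> strip T \<Longrightarrow> (v has_derivative (\<lambda>d. P z * fst d + Q z * snd d)) (at z within strip T)"
    and dP: "z \<in> strip T \<Longrightarrow> (P has_derivative (\<lambda>d. R z * fst d + S z * snd d)) (at z within strip T)"
    and dQ: "z \<in> strip T \<Longrightarrow> (Q has_derivative (\<lambda>d. S z * fst d + W z * snd d)) (at z within strip T)"
    and cont2: "continuous_on (strip T) R" "continuous_on (strip T) S" "continuous_on (strip T) W"
    and wave: "z \<in> strip T \<Longrightarrow> W z = (1 + A * (\<bar>P z\<bar> powr (p - 2) * P z)) * R z"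
begin

lemma cont: "continuous_on (strip T) v" "continuous_on (strip T) P" "continuous_on (strip T) Q"
  using dv dP dQ
  by (meson has_derivative_continuous continuous_on_eq_continuous_within)+

lemmas cont_compose = cont[THEN continuous_on_compose2] cont2[THEN continuous_on_compose2]

text \<open>In direction \<open>(b, -1)\<close> the mixed terms cancel when \<open>b\<close> is
  \<open>k\<close> times the speed, and what remains is the equation. Only the derivative at
  \<open>s = 0\<close> is claimed, so the tangent line replaces the characteristic curve and no ODE
  has to be solved.\<close>

lemma riemann_invariant_ray:
  assumes h: "\<And>s. (h has_real_derivative speed p A s) (at s)"
    and t: "0 \<le> t" "t \<le> T" and k: "k\<^sup>2 = 1"
    and c: "(speed p A (P (x, t)))\<^sup>2 = 1 + A * (\<bar>P (x, t)\<bar> powr (p - 2) * P (x, t))"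
  defines "b \<equiv> k * speed p A (P (x, t))"
  shows "((\<lambda>s. Q (x + b * s, t - s) + k * h (P (x + b * s, t - s))) has_real_derivative 0)
    (at 0 within {0..t})"
proof -
  have mem: "(x + b * s, t + (-1) * s) \<in> strip T" if "s \<in> {0..t}" for s
    using that t by (auto simp: strip_def)
  have z: "(x, t) \<in> strip T" using t by (auto simp: strip_def)
  have Q': "((\<lambda>s. Q (x + b * s, t + (-1) * s)) has_real_derivative S (x, t) * b + W (x, t) * (-1))
      (at 0 within {0..t})"
    by (rule has_derivative_line[OF _ mem]) (use dQ[OF z] in auto)
  have P': "((\<lambda>s. P (x + b * s, t + (-1) * s)) has_real_derivative R (x, t) * b + S (x, t) * (-1))
      (at 0 within {0..t})"
    by (rule has_derivative_line[OF _ mem]) (use dP[OF z] in auto)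
  have h': "((\<lambda>s. h (P (x + b * s, t + (-1) * s))) has_real_derivative
      speed p A (P (x, t)) * (R (x, t) * b + S (x, t) * (-1))) (at 0 within {0..t})"
    using DERIV_chain2[OF h P'] by simp
  have "((\<lambda>s. Q (x + b * s, t + (-1) * s) + k * h (P (x + b * s, t + (-1) * s))) has_real_derivative
     (S (x, t) * b + W (x, t) * (-1)) + k * (speed p A (P (x, t)) * (R (x, t) * b + S (x, t) * (-1))))
      (at 0 within {0..t})"
    by (intro DERIV_add DERIV_cmult Q' h')
  moreover have "(S (x, t) * b + W (x, t) * (-1)) + k * (speed p A (P (x, t)) * (R (x, t) * b + S (x, t) * (-1)))
     = (k\<^sup>2 * (speed p A (P (x, t)))\<^sup>2) * R (x, t) - W (x, t)"
    unfolding b_def by (simp add: algebra_simps power2_eq_square)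
  ultimately show ?thesis using k c wave[OF z] by simp
qed

text \<open>A bootstrap argument: as long as the slope is at most \<open>\<eta>\<close>, the maximum
  principle for the invariants improves this to \<open>2 * m < \<eta>\<close>, so by continuity the
  slope never reaches \<open>\<eta>\<close>.\<close>

lemma slope_bound:
  assumes a: "0 \<le> a" and near: "\<And>s. \<bar>s\<bar> \<le> \<eta> \<Longrightarrow> speed p A s \<le> a"
      "\<And>s. \<bar>s\<bar> \<le> \<eta> \<Longrightarrow> (speed p A s)\<^sup>2 = 1 + A * (\<bar>s\<bar> powr (p - 2) * s)"
    and h: "h 0 = 0" "\<And>s. (h has_real_derivative speed p A s) (at s)"
    and m: "2 * m < \<eta>"
    and initial: "\<And>x. l \<le> x \<Longrightarrow> x \<le> q \<Longrightarrow> \<bar>Q (x, 0)\<bar> + \<bar>h (P (x, 0))\<bar> \<le> m"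
    and z: "(x, t) \<in> trapezoid l q a T"
  shows "\<bar>Q (x, t)\<bar> \<le> m" and "\<bar>P (x, t)\<bar> \<le> 2 * m"
proof -
  \<comment> \<open>The speed is at least \<open>1/2\<close> for all slopes thanks to the cut-off,
    so a bound on \<open>h\<close> controls the slope before the slope is known to be small.\<close>
  have h_lower: "\<bar>s\<bar> \<le> 2 * \<bar>h s\<bar>" for s
  proof (cases "0 \<le> s")
    case True
    have "1/2 * (s - 0) \<le> h s - h 0"
      using True by (rule increment_ge)
        (auto intro: has_field_derivative_at_within[OF h(2)] speed_ge_half[simplified])
    then show ?thesis using True h(1) by simp
  next
    case False
    then have "1/2 * (0 - s) \<le> h 0 - h s"
      by (intro increment_ge[of s 0 h "speed p A"])
        (auto intro: has_field_derivative_at_within[OF h(2)] speed_ge_half[simplified])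
    then show ?thesis using False h(1) by simp
  qed
  have h_cont: "continuous_on UNIV h"
    using h(2) by (meson DERIV_isCont continuous_at_imp_continuous_on)
  have sub: "trapezoid l q a \<tau> \<subseteq> strip T" if "\<tau> \<le> T" for \<tau>
    using that by (auto simp: trapezoid_def strip_def)
  have bound: "\<bar>Q (x, t)\<bar> \<le> m \<and> \<bar>P (x, t)\<bar> \<le> 2 * m"
    if \<tau>: "\<tau> \<le> T" and small: "\<And>z. z \<in> trapezoid l q a \<tau> \<Longrightarrow> \<bar>P z\<bar> \<le> \<eta>"
      and z: "(x, t) \<in> trapezoid l q a \<tau>" for \<tau> x t
  proof -
    \<comment> \<open>The sign \<open>k\<close> selects the invariant and \<open>j\<close> the side
      of the estimate. The four cases together bound \<open>Q\<close> and \<open>h (P)\<close>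
      separately by \<open>m\<close>.\<close>
    have one_sided: "j * (Q (x, t) + k * h (P (x, t))) \<le> m" if j: "j\<^sup>2 = 1" and k: "k\<^sup>2 = 1" for j k
    proof (rule max_principle_trapezoid[where r = "\<lambda>z. j * (Q z + k * h (P z))", OF _ _ _ z])
      show "continuous_on (trapezoid l q a \<tau>) (\<lambda>z. j * (Q z + k * h (P z)))"
        using sub[OF \<tau>]
        by (intro continuous_intros cont_compose continuous_on_compose2[OF h_cont]) auto
      fix y s assume y: "(y, s) \<in> trapezoid l q a \<tau>"
      then have s: "0 \<le> s" "s \<le> T" using \<tau> by (auto simp: trapezoid_def)
      note ray = riemann_invariant_ray[OF h(2) s k near(2)[OF small[OF y]]]
      have "\<bar>k\<bar> = 1" using k by (auto simp: power2_eq_1_iff)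
      then have "\<bar>k * speed p A (P (y, s))\<bar> \<le> a"
        using near(1)[OF small[OF y]] speed_ge_half[of p A "P (y, s)"] by (simp add: abs_mult)
      then show "\<exists>b. \<bar>b\<bar> \<le> a \<and> ((\<lambda>r. j * (Q (y + b * r, s - r) + k * h (P (y + b * r, s - r))))
          has_real_derivative 0) (at 0 within {0..s})"
        using DERIV_cmult[OF ray, of j] by auto
    next
      fix y assume y: "l \<le> y" "y \<le> q"
      have "\<bar>j\<bar> = 1" "\<bar>k\<bar> = 1" using j k by (auto simp: power2_eq_1_iff)
      then have "\<bar>j * (Q (y, 0) + k * h (P (y, 0)))\<bar> \<le> \<bar>Q (y, 0)\<bar> + \<bar>h (P (y, 0))\<bar>"
        using abs_triangle_ineq[of "Q (y, 0)" "k * h (P (y, 0))"] by (simp add: abs_mult)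
      then show "j * (Q (y, 0) + k * h (P (y, 0))) \<le> m" using initial[OF y] by linarith
    qed
    have "\<bar>Q (x, t)\<bar> \<le> m" "\<bar>h (P (x, t))\<bar> \<le> m"
      using one_sided[of 1 1] one_sided[of 1 "-1"] one_sided[of "-1" 1] one_sided[of "-1" "-1"] by auto
    then show ?thesis using h_lower[of "P (x, t)"] by auto
  qed
  \<comment> \<open>Otherwise the compact set \<open>?B\<close> of points with large slope has a
    point \<open>(x1, t1)\<close> of least time. The vertical segment below it lies in the trapezoid
    and satisfies the improved bound, which passes to \<open>(x1, t1)\<close> by continuity.\<close>
  have "\<bar>P z\<bar> < \<eta>" if "z \<in> trapezoid l q a T" for z
  proof (rule ccontr)
    let ?B = "trapezoid l q a T \<inter> P -` {s. \<eta> \<le> \<bar>s\<bar>}"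
    assume "\<not> \<bar>P z\<bar> < \<eta>"
    then have "?B \<noteq> {}" using that by auto
    moreover have "compact ?B"
    proof -
      have "closed {s. \<eta> \<le> \<bar>s\<bar>}" by (intro closed_Collect_le continuous_intros)
      then have "closed ?B"
        by (rule continuous_closed_preimage[OF continuous_on_subset[OF cont(2) sub[OF order_refl]]
          compact_imp_closed[OF compact_trapezoid]])
      then have "compact (trapezoid l q a T \<inter> ?B)" by (rule compact_Int_closed[OF compact_trapezoid])
      then show ?thesis by (simp add: Int_assoc[symmetric])
    qed
    ultimately obtain z1 where "z1 \<in> ?B" "\<And>z. z \<in> ?B \<Longrightarrow> snd z1 \<le> snd z"
      using continuous_attains_inf[of ?B snd] continuous_on_snd[OF continuous_on_id] by blast
    then obtain x1 t1 where z1: "(x1, t1) \<in> ?B" and first: "\<And>y s. (y, s) \<in> ?B \<Longrightarrow> t1 \<le> s"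
      by (metis prod.collapse snd_conv)
    have t1: "0 \<le> t1" "t1 \<le> T" using z1 by (auto simp: trapezoid_def)
    have "t1 \<noteq> 0"
    proof
      assume "t1 = 0"
      with z1 have "\<bar>Q (x1, 0)\<bar> + \<bar>h (P (x1, 0))\<bar> \<le> m" "\<eta> \<le> \<bar>P (x1, 0)\<bar>"
        by (auto simp: trapezoid_def intro!: initial)
      then show False using h_lower[of "P (x1, 0)"] m by linarith
    qed
    have before: "\<bar>P (x1, s)\<bar> \<le> 2 * m" if s: "s \<in> {0..<t1}" for s
    proof -
      have "a * s \<le> a * t1" using s a by (auto intro: mult_left_mono)
      then have "(x1, s) \<in> trapezoid l q a s" using z1 s by (auto simp: trapezoid_def)
      moreover have "\<bar>P z\<bar> \<le> \<eta>" if "z \<in> trapezoid l q a s" for z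
        using first[of "fst z" "snd z"] that s t1 by (cases z) (force simp: trapezoid_def)
      ultimately show ?thesis using bound[of s x1 s] s t1 by auto
    qed
    have "\<bar>P (x1, t1)\<bar> \<le> 2 * m"
    proof (rule continuous_le_on_closure[where S = "{0..<t1}" and f = "\<lambda>s. \<bar>P (x1, s)\<bar>"])
      show "continuous_on (closure {0..<t1}) (\<lambda>s. \<bar>P (x1, s)\<bar>)"
        using t1 \<open>t1 \<noteq> 0\<close> by (intro continuous_intros cont_compose) (auto simp: strip_def)
    qed (use t1 \<open>t1 \<noteq> 0\<close> before in auto)
    then show False using z1 m by auto
  qed
  then show "\<bar>Q (x, t)\<bar> \<le> m" "\<bar>P (x, t)\<bar> \<le> 2 * m"
    using bound[OF order_refl _ z] by (auto intro: less_imp_le)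
qed

text \<open>For zero data the smallness hypothesis of \<open>slope_bound\<close> holds with \<open>m = 0\<close> and every
  speed \<open>a > 1\<close>; letting \<open>a\<close> tend to \<open>1\<close> gives the exact front.\<close>

lemma left_front:
  assumes initial: "\<And>x. x \<le> - \<sigma> \<Longrightarrow> v (x, 0) = 0 \<and> P (x, 0) = 0 \<and> Q (x, 0) = 0"
    and t: "0 \<le> t" "t \<le> T" and x: "x + t \<le> - \<sigma>"
  shows "v (x, t) = 0" "P (x, t) = 0" "Q (x, t) = 0"
proof -
  obtain h where h: "h 0 = 0" "\<And>s. (h has_real_derivative speed p A s) (at s)"
    using speed_antiderivative[OF p] by metis
  have strict: "P (y, s) = 0 \<and> Q (y, s) = 0" if s: "0 \<le> s" "s \<le> T" and y: "y + s < - \<sigma>" for y s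
  proof (cases "s = 0")
    case False
    \<comment> \<open>With this speed \<open>(y, s)\<close> is the tip of the triangle over the base
      from \<open>y - a * s\<close> to \<open>- \<sigma>\<close>, where the data vanish. Since
      \<open>y + s < - \<sigma>\<close>, it exceeds \<open>1\<close>.\<close>
    define a where "a = (- \<sigma> - y) / s"
    have a: "1 < a" and as: "a * s = - \<sigma> - y" using False s y by (auto simp: a_def field_simps)
    obtain \<eta> where \<eta>: "0 < \<eta>" "\<And>s. \<bar>s\<bar> \<le> \<eta> \<Longrightarrow> speed p A s \<le> a"
      "\<And>s. \<bar>s\<bar> \<le> \<eta> \<Longrightarrow> (speed p A s)\<^sup>2 = 1 + A * (\<bar>s\<bar> powr (p - 2) * s)"
      using speed_near_zero[OF p a] by metis
    have z: "(y, s) \<in> trapezoid (y - a * s) (- \<sigma>) a T"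
      using as s by (auto simp: trapezoid_def)
    show ?thesis
      using slope_bound[OF _ \<eta>(2,3) h _ _ z, where m = 0] a \<eta>(1) initial h(1) by auto
  qed (use initial y in auto)
  have weak: "P (y, s) = 0 \<and> Q (y, s) = 0" if s: "0 \<le> s" "s \<le> T" and y: "y + s \<le> - \<sigma>" for y s
  proof -
    have "continuous_on (closure {..<y}) (\<lambda>y. P (y, s))" "continuous_on (closure {..<y}) (\<lambda>y. Q (y, s))"
      using s by (auto intro!: continuous_intros cont_compose simp: strip_def)
    from this[THEN continuous_constant_on_closure, of 0 y] show ?thesis
      using strict[OF s] y by auto
  qed
  then show "P (x, t) = 0" "Q (x, t) = 0" using t x by auto
  \<comment> \<open>The vertical segment below \<open>(x, t)\<close> stays to the left of the front,
    where \<open>Q\<close> vanishes, so \<open>v\<close> keeps its initial value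
    \<open>0\<close>.\<close>
  have "((\<lambda>s. v (x, s)) has_real_derivative 0) (at s within {0..t})" if "s \<in> {0..t}" for s
  proof -
    have "((\<lambda>s. v (x + 0 * s, 0 + 1 * s)) has_real_derivative P (x, s) * 0 + Q (x, s) * 1) (at s within {0..t})"
      by (rule has_derivative_line[where X = "strip T"]) (use dv that t in \<open>auto simp: strip_def\<close>)
    then show ?thesis using weak[of s x] that t x by auto
  qed
  from has_field_derivative_zero_constant[OF _ this] obtain c where "\<And>s. s \<in> {0..t} \<Longrightarrow> v (x, s) = c"
    by auto
  from this[of 0] this[of t] show "v (x, t) = 0" using initial t x by auto
qed

section \<open>Left-moving coordinates and growth of the weighted means\<close>

lemma left_moving_time_derivative:
  fixes y :: real
  assumes u: "\<And>z. z \<in> strip T \<Longrightarrow> (u has_derivative (\<lambda>d. u1 z * fst d + u2 z * snd d)) (at z within strip T)"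
    and t: "t \<in> {0..T}"
  shows "((\<lambda>t. u (y - t, t)) has_real_derivative u2 (y - t, t) - u1 (y - t, t)) (at t within {0..T})"
proof -
  have "((\<lambda>t. u (y + (-1) * t, 0 + 1 * t)) has_real_derivative u1 (y - t, t) * (-1) + u2 (y - t, t) * 1)
      (at t within {0..T})"
    by (rule has_derivative_line[where X = "strip T"]) (use u t in \<open>auto simp: strip_def\<close>)
  then show ?thesis by simp
qed

lemma left_moving_space_derivative:
  fixes y :: real
  assumes u: "\<And>z. z \<in> strip T \<Longrightarrow> (u has_derivative (\<lambda>d. u1 z * fst d + u2 z * snd d)) (at z within strip T)"
    and t: "t \<in> {0..T}"
  shows "((\<lambda>y. u (y - t, t)) has_real_derivative u1 (y - t, t)) (at y within U)"
proof -
  have "((\<lambda>y. u ((- t) + 1 * y, t + 0 * y)) has_real_derivative u1 (y - t, t) * 1 + u2 (y - t, t) * 0)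
      (at y within U)"
    by (rule has_derivative_line[where X = "strip T"]) (use u t in \<open>auto simp: strip_def\<close>)
  then show ?thesis by simp
qed

text \<open>In the coordinates \<open>y = x + t\<close> and \<open>t\<close> the equation reads
  \<open>V\<^sub>t\<^sub>t + 2 V\<^sub>y\<^sub>t = (A / p) (\<bar>V\<^sub>y\<bar>\<^sup>p)\<^sub>y\<close>; testing it with \<open>\<sigma> - y\<close> produces the part with \<open>\<mu> = 0\<close>.\<close>

definition functional :: "real \<Rightarrow> real \<Rightarrow> real \<Rightarrow> real" where
  "functional \<sigma> \<mu> t = integral {- \<sigma>..\<sigma>} (\<lambda>y. (2 + \<mu> * (\<sigma> - y)) * v (y - t, t)
     + (\<sigma> - y) * (Q (y - t, t) - P (y - t, t)))"

text \<open>By the equation, the second-order terms of the differentiated integrand are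
  \<open>\<sigma> - y\<close> times the \<open>y\<close>-derivative of
  \<open>A / p * \<bar>P\<bar> powr p - 2 * (Q - P)\<close>. In the integration by parts the weight
  kills the boundary term at \<open>\<sigma>\<close> and the front the one at
  \<open>- \<sigma>\<close>; the terms \<open>2 * (Q - P)\<close> then cancel.\<close>

lemma functional_derivative:
  assumes \<sigma>: "0 < \<sigma>" and t: "t \<in> {0..T}"
    and front: "P (- \<sigma> - t, t) = 0" "Q (- \<sigma> - t, t) = 0"
  shows "(functional \<sigma> \<mu> has_real_derivative
      integral {- \<sigma>..\<sigma>} (\<lambda>y. A / p * \<bar>P (y - t, t)\<bar> powr p
        + \<mu> * (\<sigma> - y) * (Q (y - t, t) - P (y - t, t)))) (at t within {0..T})"
proof -
  let ?g = "\<lambda>t y. (2 + \<mu> * (\<sigma> - y)) * v (y - t, t) + (\<sigma> - y) * (Q (y - t, t) - P (y - t, t))"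
  let ?g' = "\<lambda>t y. (2 + \<mu> * (\<sigma> - y)) * (Q (y - t, t) - P (y - t, t))
      + (\<sigma> - y) * (W (y - t, t) - S (y - t, t) - (S (y - t, t) - R (y - t, t)))"
  have cont_g: "continuous_on {- \<sigma>..\<sigma>} (?g s)" if "s \<in> {0..T}" for s
    by (intro continuous_intros cont_compose) (use that in \<open>auto simp: strip_def\<close>)
  have cont_g': "continuous_on {- \<sigma>..\<sigma>} (?g' s)" if "s \<in> {0..T}" for s
    by (intro continuous_intros cont_compose) (use that in \<open>auto simp: strip_def\<close>)
  have "((\<lambda>t. integral (cbox (- \<sigma>) \<sigma>) (?g t)) has_real_derivative integral (cbox (- \<sigma>) \<sigma>) (?g' t))
      (at t within {0..T})"
  proof (rule leibniz_rule_field_derivative)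
    fix s y assume "s \<in> {0..T}"
    then show "((\<lambda>t. ?g t y) has_real_derivative ?g' s y) (at s within {0..T})"
      by (intro DERIV_add DERIV_cmult DERIV_diff left_moving_time_derivative[OF dv]
        left_moving_time_derivative[OF dP] left_moving_time_derivative[OF dQ])
  next
    show "continuous_on ({0..T} \<times> cbox (- \<sigma>) \<sigma>) (\<lambda>(t, y). ?g' t y)"
      unfolding split_beta
      by (intro continuous_intros cont_compose) (auto simp: strip_def)
  qed (use t cont_g in \<open>auto intro: integrable_continuous_real\<close>)
  moreover have "integral {- \<sigma>..\<sigma>} (?g' t) = integral {- \<sigma>..\<sigma>} (\<lambda>y. A / p * \<bar>P (y - t, t)\<bar> powr p
        + \<mu> * (\<sigma> - y) * (Q (y - t, t) - P (y - t, t)))"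
  proof -
    \<comment> \<open>Since \<open>?H\<close> vanishes at both ends, \<open>?H'\<close> has integral
      \<open>0\<close>; subtracting it removes all second derivatives from
      \<open>?g'\<close>.\<close>
    let ?H = "\<lambda>y. (\<sigma> - y) * (A / p * \<bar>P (y - t, t)\<bar> powr p - 2 * (Q (y - t, t) - P (y - t, t)))"
    let ?H' = "\<lambda>y. - (A / p * \<bar>P (y - t, t)\<bar> powr p - 2 * (Q (y - t, t) - P (y - t, t)))
      + (\<sigma> - y) * (A * (\<bar>P (y - t, t)\<bar> powr (p - 2) * P (y - t, t)) * R (y - t, t)
        - 2 * (S (y - t, t) - R (y - t, t)))"
    have "(?H' has_integral (?H \<sigma> - ?H (- \<sigma>))) {- \<sigma>..\<sigma>}"
    proof (rule fundamental_theorem_of_calculus)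
      fix y
      define E where "E = (\<lambda>y. \<bar>P (y - t, t)\<bar> powr p)"
      have "(E has_real_derivative
          p * (\<bar>P (y - t, t)\<bar> powr (p - 2) * P (y - t, t)) * R (y - t, t)) (at y within {- \<sigma>..\<sigma>})"
        unfolding E_def by (rule DERIV_chain2[OF DERIV_abs_powr[OF p] left_moving_space_derivative[OF dP t]])
      then have "((\<lambda>y. (\<sigma> - y) * (A / p * E y - 2 * (Q (y - t, t) - P (y - t, t))))
          has_real_derivative - (A / p * E y - 2 * (Q (y - t, t) - P (y - t, t)))
      + (\<sigma> - y) * (A * (\<bar>P (y - t, t)\<bar> powr (p - 2) * P (y - t, t)) * R (y - t, t)
        - 2 * (S (y - t, t) - R (y - t, t)))) (at y within {- \<sigma>..\<sigma>})"
        using p by (auto intro!: derivative_eq_intros left_moving_space_derivative[OF dP t]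
          left_moving_space_derivative[OF dQ t])
      then show "(?H has_vector_derivative ?H' y) (at y within {- \<sigma>..\<sigma>})"
        by (simp add: E_def has_real_derivative_iff_has_vector_derivative)
    qed (use \<sigma> in simp)
    moreover have "?H \<sigma> - ?H (- \<sigma>) = 0" using front p by simp
    ultimately have H': "(?H' has_integral 0) {- \<sigma>..\<sigma>}" by (simp only:)
    have "(?g' t has_integral integral {- \<sigma>..\<sigma>} (?g' t)) {- \<sigma>..\<sigma>}"
      by (intro integrable_integral integrable_continuous_real cont_g' t)
    from has_integral_diff[OF this H'] have *: "((\<lambda>y. ?g' t y - ?H' y) has_integral
      integral {- \<sigma>..\<sigma>} (?g' t)) {- \<sigma>..\<sigma>}" by (simp only: diff_0_right)
    have eq: "?g' t y - ?H' y = A / p * \<bar>P (y - t, t)\<bar> powr p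
        + \<mu> * (\<sigma> - y) * (Q (y - t, t) - P (y - t, t))" for y
    proof -
      have "W (y - t, t) = (1 + A * (\<bar>P (y - t, t)\<bar> powr (p - 2) * P (y - t, t))) * R (y - t, t)"
        using t by (intro wave) (auto simp: strip_def)
      then show ?thesis by (simp add: algebra_simps)
    qed
    show ?thesis using * unfolding eq by (rule integral_unique[symmetric])
  qed
  ultimately show ?thesis unfolding functional_def[abs_def] by simp
qed

text \<open>The slope \<open>\<theta>\<close> is where the gain \<open>A / p * \<bar>P\<bar> powr p\<close> outweighs the loss
  \<open>4 * \<sigma> * \<mu> * \<bar>P\<bar>\<close>; below it the loss amounts to at most \<open>\<mu> * c / 2\<close> after integration.\<close>

lemma lifespan_bound:
  fixes \<sigma> c B :: real
  defines "\<theta> \<equiv> c / (16 * \<sigma>\<^sup>2)"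
  defines "\<mu> \<equiv> A / (4 * \<sigma> * p) * \<theta> powr (p - 1)"
  assumes T: "0 < T" and \<sigma>: "0 < \<sigma>" and c: "0 < c" and initial: "c \<le> functional \<sigma> 0 0"
    and front: "\<And>t. t \<in> {0..T} \<Longrightarrow> v (- \<sigma> - t, t) = 0 \<and> P (- \<sigma> - t, t) = 0 \<and> Q (- \<sigma> - t, t) = 0"
    and bounds: "\<And>z. z \<in> strip T \<Longrightarrow> \<bar>Q z\<bar> \<le> B" "\<And>z. z \<in> strip T \<Longrightarrow> \<bar>P z\<bar> \<le> 2 * B"
  shows "\<mu> * c / 2 * T \<le> 4 * \<sigma> * B * (14 * \<sigma> + 8 * \<mu> * \<sigma>\<^sup>2)"
proof -
  have \<theta>: "0 < \<theta>" using c \<sigma> by (simp add: \<theta>_def)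
  then have \<mu>: "0 < \<mu>" using A p \<sigma> by (simp add: \<mu>_def)
  have B: "0 \<le> B" using bounds(1)[of "(0, 0)"] T by (auto simp: strip_def)
  have integrable: "\<phi> integrable_on {- \<sigma>..\<sigma>}" if "continuous_on {- \<sigma>..\<sigma>} \<phi>" for \<phi> :: "real \<Rightarrow> real"
    using that by (rule integrable_continuous_real)
  \<comment> \<open>Integrate the slope, at most \<open>2 * B\<close>, from the front, where
    \<open>v = 0\<close>, over a length of at most \<open>2 * \<sigma>\<close>.\<close>
  have v_bound: "\<bar>v (y - t, t)\<bar> \<le> 4 * \<sigma> * B" if t: "t \<in> {0..T}" and y: "y \<in> {- \<sigma>..\<sigma>}" for t y
  proof -
    have "norm (v (y - t, t) - v (- \<sigma> - t, t)) \<le> 2 * B * norm (y - (- \<sigma>))"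
    proof (rule field_differentiable_bound[of "{- \<sigma>..\<sigma>}"])
      fix y
      show "((\<lambda>y. v (y - t, t)) has_real_derivative P (y - t, t)) (at y within {- \<sigma>..\<sigma>})"
        by (rule left_moving_space_derivative[OF dv t])
      show "norm (P (y - t, t)) \<le> 2 * B" using bounds(2) t by (simp add: strip_def)
    qed (use y \<sigma> in auto)
    also have "\<dots> \<le> 2 * B * (2 * \<sigma>)" using y B by (intro mult_left_mono) auto
    finally show ?thesis using front[OF t] by (simp add: mult_ac)
  qed
  have P_cont: "continuous_on {- \<sigma>..\<sigma>} (\<lambda>y. P (y - t, t))"
    and Q_cont: "continuous_on {- \<sigma>..\<sigma>} (\<lambda>y. Q (y - t, t))"
    and v_cont: "continuous_on {- \<sigma>..\<sigma>} (\<lambda>y. v (y - t, t))" if "t \<in> {0..T}" for t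
    using that by (auto intro!: continuous_intros cont_compose simp: strip_def)
  have powr_cont: "continuous_on {- \<sigma>..\<sigma>} (\<lambda>y. \<bar>P (y - t, t)\<bar> powr p)" if "t \<in> {0..T}" for t
    using p by (intro continuous_on_powr' continuous_intros P_cont that) auto
  note conts = P_cont Q_cont v_cont powr_cont
  have large: "c \<le> functional \<sigma> 0 t" if t: "t \<in> {0..T}" for t
  proof -
    have "0 * (t - 0) \<le> functional \<sigma> 0 t - functional \<sigma> 0 0"
    proof (rule increment_ge)
      fix s assume s: "s \<in> {0..t}"
      then have s': "s \<in> {0..T}" using t by auto
      show "(functional \<sigma> 0 has_real_derivative
        integral {- \<sigma>..\<sigma>} (\<lambda>y. A / p * \<bar>P (y - s, s)\<bar> powr p)) (at s within {0..t})"
        using functional_derivative[OF \<sigma> s', of 0] front[OF s'] t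
        by (auto intro: DERIV_subset)
      show "0 \<le> integral {- \<sigma>..\<sigma>} (\<lambda>y. A / p * \<bar>P (y - s, s)\<bar> powr p)"
        using A p by (intro integral_nonneg integrable continuous_intros conts s') auto
    qed (use t in auto)
    then show ?thesis using initial by simp
  qed
  have v_parts: "integral {- \<sigma>..\<sigma>} (\<lambda>y. v (y - t, t)) = integral {- \<sigma>..\<sigma>} (\<lambda>y. (\<sigma> - y) * P (y - t, t))"
    if t: "t \<in> {0..T}" for t
  proof -
    have "((\<lambda>y. (\<sigma> - y) * P (y - t, t) - v (y - t, t)) has_integral
      ((\<sigma> - \<sigma>) * v (\<sigma> - t, t) - (\<sigma> - - \<sigma>) * v (- \<sigma> - t, t))) {- \<sigma>..\<sigma>}"
    proof (rule fundamental_theorem_of_calculus)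
      fix y
      have "((\<lambda>y. (\<sigma> - y) * v (y - t, t)) has_real_derivative (\<sigma> - y) * P (y - t, t) - v (y - t, t))
          (at y within {- \<sigma>..\<sigma>})"
        by (auto intro!: derivative_eq_intros left_moving_space_derivative[OF dv t])
      then show "((\<lambda>y. (\<sigma> - y) * v (y - t, t)) has_vector_derivative (\<sigma> - y) * P (y - t, t) - v (y - t, t))
          (at y within {- \<sigma>..\<sigma>})"
        by (simp add: has_real_derivative_iff_has_vector_derivative)
    qed (use \<sigma> in simp)
    then have "integral {- \<sigma>..\<sigma>} (\<lambda>y. (\<sigma> - y) * P (y - t, t) - v (y - t, t)) = 0"
      using front[OF t] by (simp add: integral_unique)
    moreover have "integral {- \<sigma>..\<sigma>} (\<lambda>y. (\<sigma> - y) * P (y - t, t) - v (y - t, t))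
      = integral {- \<sigma>..\<sigma>} (\<lambda>y. (\<sigma> - y) * P (y - t, t)) - integral {- \<sigma>..\<sigma>} (\<lambda>y. v (y - t, t))"
      by (intro Henstock_Kurzweil_Integration.integral_diff integrable continuous_intros conts t)
    ultimately show ?thesis by simp
  qed
  \<comment> \<open>Replace the weighted mean of \<open>Q - P\<close> by
    \<open>functional \<sigma> 0 t\<close> minus twice the mean of \<open>v\<close>, and the latter
    by a mean of \<open>P\<close> using \<open>v_parts\<close>. The first part contributes at least
    \<open>\<mu> * c\<close>; the second joins the gain in \<open>?N\<close>.\<close>
  have growth: "\<mu> * c / 2 \<le> integral {- \<sigma>..\<sigma>} (\<lambda>y. A / p * \<bar>P (y - t, t)\<bar> powr p
        + \<mu> * (\<sigma> - y) * (Q (y - t, t) - P (y - t, t)))" if t: "t \<in> {0..T}" for t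
  proof -
    let ?w = "\<lambda>y. Q (y - t, t) - P (y - t, t)"
    let ?N = "\<lambda>y. A / p * \<bar>P (y - t, t)\<bar> powr p - 2 * \<mu> * ((\<sigma> - y) * P (y - t, t))"
    have pointwise: "- (4 * \<sigma> * \<mu> * \<theta>) \<le> ?N y" if y: "y \<in> {- \<sigma>..\<sigma>}" for y
    proof -
      define s where "s = \<bar>P (y - t, t)\<bar>"
      have "(\<sigma> - y) * P (y - t, t) \<le> 2 * \<sigma> * s"
        using mult_mono[of "\<sigma> - y" "2 * \<sigma>" s s] mult_left_mono[OF abs_ge_self[of "P (y - t, t)"], of "\<sigma> - y"] y \<sigma>
        unfolding s_def by auto
      then have loss: "2 * \<mu> * ((\<sigma> - y) * P (y - t, t)) \<le> 4 * \<sigma> * \<mu> * s"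
        using \<mu> mult_left_mono[of _ _ "2 * \<mu>"] by fastforce
      show ?thesis
      proof (cases "s \<le> \<theta>")
        case True
        have "4 * \<sigma> * \<mu> * s \<le> 4 * \<sigma> * \<mu> * \<theta>" using True \<mu> \<sigma> by (intro mult_left_mono) auto
        moreover have "0 \<le> A / p * s powr p" using A p by simp
        ultimately show ?thesis using loss unfolding s_def by linarith
      next
        case False
        then have s: "\<theta> \<le> s" "0 < s" using \<theta> by auto
        have "4 * \<sigma> * \<mu> = A / p * \<theta> powr (p - 1)" using \<sigma> by (simp add: \<mu>_def)
        also have "\<dots> \<le> A / p * s powr (p - 1)"
          using A p s \<theta> by (intro mult_left_mono powr_mono2) auto
        finally have "4 * \<sigma> * \<mu> * s \<le> A / p * s powr (p - 1) * s"
          using s by (intro mult_right_mono) auto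
        also have "\<dots> = A / p * s powr p" using s powr_mult_base[of s "p - 1"] by (simp add: mult.commute)
        finally have "0 \<le> ?N y" using loss unfolding s_def by linarith
        moreover have "0 \<le> 4 * \<sigma> * \<mu> * \<theta>" using \<sigma> \<mu> \<theta> by simp
        ultimately show ?thesis by linarith
      qed
    qed
    have gain: "integral {- \<sigma>..\<sigma>} (\<lambda>y. - (4 * \<sigma> * \<mu> * \<theta>)) \<le> integral {- \<sigma>..\<sigma>} ?N"
      by (intro integral_le integrable continuous_intros conts t pointwise)
    \<comment> \<open>The length \<open>2 * \<sigma>\<close> gives
      \<open>8 * \<sigma>\<^sup>2 * \<mu> * \<theta>\<close>; the \<open>16\<close> in
      \<open>\<theta>\<close> makes the loss exactly half of \<open>\<mu> * c\<close>.\<close>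
    have gain_eq: "integral {- \<sigma>..\<sigma>} (\<lambda>y. - (4 * \<sigma> * \<mu> * \<theta>)) = - (\<mu> * c / 2)"
      using \<sigma> by (simp add: \<theta>_def power2_eq_square field_simps)
    have N: "integral {- \<sigma>..\<sigma>} ?N = A / p * integral {- \<sigma>..\<sigma>} (\<lambda>y. \<bar>P (y - t, t)\<bar> powr p)
       - 2 * \<mu> * integral {- \<sigma>..\<sigma>} (\<lambda>y. (\<sigma> - y) * P (y - t, t))"
      by (subst Henstock_Kurzweil_Integration.integral_diff)
         (use p in \<open>auto intro!: integrable continuous_intros conts t\<close>)
    have F: "functional \<sigma> 0 t = 2 * integral {- \<sigma>..\<sigma>} (\<lambda>y. v (y - t, t))
        + integral {- \<sigma>..\<sigma>} (\<lambda>y. (\<sigma> - y) * ?w y)"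
      unfolding functional_def
      by (subst Henstock_Kurzweil_Integration.integral_add)
         (use p in \<open>auto intro!: integrable continuous_intros conts t\<close>)
    have rate: "integral {- \<sigma>..\<sigma>} (\<lambda>y. A / p * \<bar>P (y - t, t)\<bar> powr p + \<mu> * (\<sigma> - y) * ?w y)
      = A / p * integral {- \<sigma>..\<sigma>} (\<lambda>y. \<bar>P (y - t, t)\<bar> powr p) + \<mu> * integral {- \<sigma>..\<sigma>} (\<lambda>y. (\<sigma> - y) * ?w y)"
      unfolding mult.assoc
      by (subst Henstock_Kurzweil_Integration.integral_add)
         (use p in \<open>auto intro!: integrable continuous_intros conts t\<close>)
    have regroup: "x + \<mu> * w = (x - 2 * \<mu> * z) + \<mu> * (2 * z + w)" for x w z :: real
      by (simp add: algebra_simps)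
    have "integral {- \<sigma>..\<sigma>} (\<lambda>y. A / p * \<bar>P (y - t, t)\<bar> powr p + \<mu> * (\<sigma> - y) * ?w y)
      = integral {- \<sigma>..\<sigma>} ?N + \<mu> * functional \<sigma> 0 t"
      unfolding rate N F v_parts[OF t] by (rule regroup)
    moreover have "\<mu> * c \<le> \<mu> * functional \<sigma> 0 t" using large[OF t] \<mu> by (intro mult_left_mono) auto
    ultimately show ?thesis using gain unfolding gain_eq by linarith
  qed
  have increase: "\<mu> * c / 2 * (T - 0) \<le> functional \<sigma> \<mu> T - functional \<sigma> \<mu> 0"
    using T growth functional_derivative[OF \<sigma>] front by (intro increment_ge) auto
  \<comment> \<open>The integrand is at most \<open>(2 + 2 * \<sigma> * \<mu>) * 4 * \<sigma> * B +
    2 * \<sigma> * 3 * B\<close>, on an interval of length \<open>2 * \<sigma>\<close>.\<close>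
  have "\<bar>functional \<sigma> \<mu> t\<bar> \<le> 2 * \<sigma> * B * (14 * \<sigma> + 8 * \<mu> * \<sigma>\<^sup>2)" if t: "t \<in> {0..T}" for t
  proof -
    let ?g = "\<lambda>y. (2 + \<mu> * (\<sigma> - y)) * v (y - t, t) + (\<sigma> - y) * (Q (y - t, t) - P (y - t, t))"
    have "norm (integral {- \<sigma>..\<sigma>} ?g) \<le> B * (14 * \<sigma> + 8 * \<mu> * \<sigma>\<^sup>2) * (\<sigma> - - \<sigma>)"
    proof (rule integral_bound)
      fix y assume y: "y \<in> {- \<sigma>..\<sigma>}"
      have "\<bar>Q (y - t, t) - P (y - t, t)\<bar> \<le> 3 * B"
        using bounds[of "(y - t, t)"] t by (auto simp: strip_def)
      then have w: "\<bar>(\<sigma> - y) * (Q (y - t, t) - P (y - t, t))\<bar> \<le> (2 * \<sigma>) * (3 * B)"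
        unfolding abs_mult using y \<sigma> by (intro mult_mono) auto
      have "\<mu> * (\<sigma> - y) \<le> \<mu> * (2 * \<sigma>)" using y \<mu> by (intro mult_left_mono) auto
      then have "\<bar>2 + \<mu> * (\<sigma> - y)\<bar> \<le> 2 + \<mu> * (2 * \<sigma>)" using y \<mu> by simp
      then have "\<bar>(2 + \<mu> * (\<sigma> - y)) * v (y - t, t)\<bar> \<le> (2 + \<mu> * (2 * \<sigma>)) * (4 * \<sigma> * B)"
        unfolding abs_mult using v_bound[OF t y] \<mu> \<sigma> by (intro mult_mono) auto
      with w have "\<bar>?g y\<bar> \<le> (2 + \<mu> * (2 * \<sigma>)) * (4 * \<sigma> * B) + (2 * \<sigma>) * (3 * B)" by linarith
      then show "norm (?g y) \<le> B * (14 * \<sigma> + 8 * \<mu> * \<sigma>\<^sup>2)"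
        by (simp add: algebra_simps power2_eq_square)
    qed (use \<sigma> in \<open>auto intro!: continuous_intros conts t\<close>)
    then show ?thesis using \<sigma> by (simp add: functional_def mult_ac)
  qed
  from this[of 0] this[of T] have "functional \<sigma> \<mu> T - functional \<sigma> \<mu> 0 \<le> 4 * \<sigma> * B * (14 * \<sigma> + 8 * \<mu> * \<sigma>\<^sup>2)"
    using T by simp
  with increase show ?thesis by simp
qed

end

section \<open>Classical solutions\<close>

lemma C1_strip_partials:
  assumes "C1_strip T u" "t \<in> {0..T}"
  shows "((\<lambda>y. u (y, t)) has_real_derivative dx u (x, t)) (at x)"
    and "((\<lambda>s. u (x, s)) has_real_derivative dt T u (x, t)) (at t within {0..T})"
proof -
  have "(\<lambda>y. u (y, t)) differentiable (at x)" "(\<lambda>s. u (x, s)) differentiable (at t within {0..T})"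
    using assms by (auto simp: C1_strip_def strip_def)
  then show "((\<lambda>y. u (y, t)) has_real_derivative dx u (x, t)) (at x)"
    and "((\<lambda>s. u (x, s)) has_real_derivative dt T u (x, t)) (at t within {0..T})"
    by (simp_all only: dx_def dt_def prod.case DERIV_deriv_iff_real_differentiable
      has_real_derivative_iff_has_vector_derivative[of "\<lambda>s. u (x, s)"]
      vector_derivative_works[symmetric])
qed

text \<open>Existence of the \<open>x\<close>-partial together with continuity of the
  \<open>t\<close>-partial gives total differentiability, one-sided in time at the end
  times.\<close>

lemma C1_strip_has_derivative:
  assumes u: "C1_strip T u" and z: "z \<in> strip T"
  shows "(u has_derivative (\<lambda>d. dx u z * fst d + dt T u z * snd d)) (at z within strip T)"
proof -
  obtain x t where xt: "z = (x, t)" "t \<in> {0..T}" using z by (cases z) (auto simp: strip_def)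
  have "continuous_on (strip T) (dt T u)" using u by (simp add: C1_strip_def)
  then have "continuous (at (x, t) within UNIV \<times> {0..T}) (\<lambda>(x, t). blinfun_mult_right (dt T u (x, t)))"
    using xt by (auto simp: strip_def continuous_on_eq_continuous_within case_prod_eta[of "\<lambda>z. blinfun_mult_right (dt T u z)"]
      intro!: bounded_linear.continuous[OF bounded_linear_blinfun_mult_right])
  from has_derivative_partialsI[where f = "\<lambda>x t. u (x, t)" and X = UNIV and Y = "{0..T}", OF _ _ this]
    C1_strip_partials[OF u]
  have "((\<lambda>(x, t). u (x, t)) has_derivative
      (\<lambda>(a, b). dx u (x, t) * a + blinfun_mult_right (dt T u (x, t)) b)) (at (x, t) within UNIV \<times> {0..T})"
    using xt(2) by (auto simp: has_field_derivative_def)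
  then show ?thesis by (simp add: xt strip_def split_beta')
qed

text \<open>Write a spatial increment of \<open>u\<close> as an integral of \<open>dx u\<close>,
  differentiate under the integral in \<open>t\<close>, then differentiate in the upper limit. The
  base point \<open>x - 1\<close> merely makes \<open>x\<close> interior to
  \<open>?I\<close>.\<close>

lemma C2_strip_mixed_partials:
  assumes T: "0 < T" and u: "C2_strip T u" and t: "t \<in> {0..T}"
  shows "dx (dt T u) (x, t) = dt T (dx u) (x, t)"
proof -
  have C1: "C1_strip T u" "C1_strip T (dx u)" "C1_strip T (dt T u)" using u by (auto simp: C2_strip_def)
  let ?I = "{x - 1..x + 1}"
  have cont: "continuous_on ?I (\<lambda>y. dt T (dx u) (y, t))"
    "continuous_on ({0..T} \<times> {x - 1..y}) (\<lambda>(t, x). dt T (dx u) (x, t))"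
    "s \<in> {0..T} \<Longrightarrow> continuous_on {x - 1..y} (\<lambda>y. dx u (y, s))" for y s
    using C1(2) t unfolding C1_strip_def split_beta
    by (auto intro!: continuous_intros elim!: continuous_on_compose2 simp: strip_def)
  have "dt T u (y, t) - dt T u (x - 1, t) = integral {x - 1..y} (\<lambda>y. dt T (dx u) (y, t))" if y: "y \<in> ?I" for y
  proof -
    have eq: "u (y, s) - u (x - 1, s) = integral (cbox (x - 1) y) (\<lambda>y. dx u (y, s))" if s: "s \<in> {0..T}" for s
    proof -
      have "((\<lambda>y. dx u (y, s)) has_integral (u (y, s) - u (x - 1, s))) {x - 1..y}"
        using y C1_strip_partials(1)[OF C1(1) s]
        by (intro fundamental_theorem_of_calculus)
           (auto simp: has_real_derivative_iff_has_vector_derivative[symmetric] intro: has_field_derivative_at_within)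
      then show ?thesis by (simp add: integral_unique)
    qed
    have "((\<lambda>s. integral (cbox (x - 1) y) (\<lambda>y. dx u (y, s))) has_real_derivative
        integral (cbox (x - 1) y) (\<lambda>y. dt T (dx u) (y, t))) (at t within {0..T})"
    proof (rule leibniz_rule_field_derivative)
      show "continuous_on ({0..T} \<times> cbox (x - 1) y) (\<lambda>(t, y). dt T (dx u) (y, t))"
        using cont(2) by simp
    qed (use t C1_strip_partials(2)[OF C1(2)] cont(3) in \<open>auto intro!: integrable_continuous_real\<close>)
    then have "((\<lambda>s. u (y, s) - u (x - 1, s)) has_real_derivative
        integral (cbox (x - 1) y) (\<lambda>y. dt T (dx u) (y, t))) (at t within {0..T})"
      by (rule has_field_derivative_transform_within[OF _ zero_less_one t]) (use eq in auto)
    moreover have "((\<lambda>s. u (y, s) - u (x - 1, s)) has_real_derivative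
        dt T u (y, t) - dt T u (x - 1, t)) (at t within {0..T})"
      by (intro DERIV_diff C1_strip_partials(2)[OF C1(1) t])
    ultimately show ?thesis
      using vector_derivative_unique_within_closed_interval[of 0 T t] T t
      by (auto simp: has_real_derivative_iff_has_vector_derivative)
  qed
  then have "((\<lambda>y. dt T u (y, t) - dt T u (x - 1, t)) has_real_derivative dt T (dx u) (x, t)) (at x within ?I)"
    by (intro has_field_derivative_transform_within[OF integral_has_real_derivative[OF cont(1)] zero_less_one]) auto
  then have "((\<lambda>y. dt T u (y, t) - dt T u (x - 1, t)) has_real_derivative dt T (dx u) (x, t)) (at x)"
    by (simp add: at_within_Icc_at)
  moreover have "((\<lambda>y. dt T u (y, t) - dt T u (x - 1, t)) has_real_derivative dx (dt T u) (x, t) - 0) (at x)"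
    by (intro DERIV_diff C1_strip_partials(1)[OF C1(3) t] DERIV_const)
  ultimately show ?thesis using DERIV_unique by fastforce
qed

lemma classical_solution_quasilinear_wave:
  assumes p: "1 < p" and A: "0 < A" and T: "0 < T" and v: "classical_solution p A v0 v1 T v"
  shows "quasilinear_wave p A T v (dx v) (dt T v) (dx (dx v)) (dt T (dx v)) (dt T (dt T v))"
proof
  have C2: "C2_strip T v" using v by (simp add: classical_solution_def)
  then have C1: "C1_strip T v" "C1_strip T (dx v)" "C1_strip T (dt T v)" by (auto simp: C2_strip_def)
  show "continuous_on (strip T) (dx (dx v))" "continuous_on (strip T) (dt T (dx v))"
    "continuous_on (strip T) (dt T (dt T v))"
    using C1 by (auto simp: C1_strip_def)
  then have conts: "continuous_on (strip T) (dx (dx v))" "continuous_on (strip T) (dt T (dt T v))"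
    "continuous_on (strip T) (dx v)"
    using C1 by (auto simp: C1_strip_def)
  fix z assume z: "z \<in> strip T"
  show "(v has_derivative (\<lambda>d. dx v z * fst d + dt T v z * snd d)) (at z within strip T)"
    "(dx v has_derivative (\<lambda>d. dx (dx v) z * fst d + dt T (dx v) z * snd d)) (at z within strip T)"
    using C1 z by (auto intro: C1_strip_has_derivative)
  have "dx (dt T v) z = dt T (dx v) z"
    using C2_strip_mixed_partials[OF T C2] z by (cases z) (auto simp: strip_def)
  then show "(dt T v has_derivative (\<lambda>d. dt T (dx v) z * fst d + dt T (dt T v) z * snd d)) (at z within strip T)"
    using C1_strip_has_derivative[OF C1(3) z] by simp
  let ?\<phi> = "\<lambda>s. \<bar>s\<bar> powr (p - 2) * s"
  \<comment> \<open>The defect of the equation is continuous and vanishes for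
    \<open>0 < t < T\<close>, hence also at both end times.\<close>
  define E where "E = (\<lambda>z. dt T (dt T v) z - (1 + A * ?\<phi> (dx v z)) * dx (dx v) z)"
  have closure: "closure (UNIV \<times> {0<..<T}) = strip T"
    using T by (simp add: closure_Times strip_def)
  have "continuous_on UNIV ?\<phi>"
    using isCont_abs_powr_times_self[OF p] by (simp add: continuous_on_eq_continuous_at)
  then have "continuous_on (strip T) (\<lambda>z. ?\<phi> (dx v z))"
    by (rule continuous_on_compose2[OF _ conts(3)]) auto
  then have "continuous_on (strip T) E"
    unfolding E_def
    by (intro continuous_on_diff continuous_on_mult[OF continuous_on_add] continuous_on_const
      continuous_on_mult_left conts)
  moreover have "E y = 0" if y: "y \<in> UNIV \<times> {0<..<T}" for y
  proof -
    have "dt T (dt T v) y - dx (dx v) y = A * ?\<phi> (dx v y) * dx (dx v) y"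
      using v y by (cases y) (auto simp: classical_solution_def)
    then show ?thesis by (simp add: E_def distrib_right)
  qed
  ultimately have "E z = 0"
    using continuous_constant_on_closure[of "UNIV \<times> {0<..<T}" E 0 z] z unfolding closure by blast
  then show "dt T (dt T v) z = (1 + A * ?\<phi> (dx v z)) * dx (dx v) z" by (simp add: E_def)
qed (rule p A)+

section \<open>Upper bound of the lifespan\<close>

lemma vanishing_from_left:
  fixes g :: "real \<Rightarrow> real"
  assumes "continuous_on UNIV g" "\<And>x. x < a \<Longrightarrow> g x = 0" "x \<le> a"
  shows "g x = 0"
  using continuous_constant_on_closure[of "{..<a}" g 0 x] assms
  by (auto intro: continuous_on_subset)

lemma vanishing_from_right:
  fixes g :: "real \<Rightarrow> real"
  assumes "continuous_on UNIV g" "\<And>x. a < x \<Longrightarrow> g x = 0" "a \<le> x"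
  shows "g x = 0"
  using continuous_constant_on_closure[of "{a<..}" g 0 x] assms
  by (auto intro: continuous_on_subset)

theorem theorem2p1:
  fixes p A \<sigma> :: real and f g :: "real \<Rightarrow> real"
  assumes "p > 1" and "A > 0" and "\<sigma> \<ge> 1"
    and "C0k 2 f" and "C0k 1 g"
    and "\<And>x. x \<notin> {x. \<bar>x\<bar> \<le> \<sigma>} \<Longrightarrow> f x = 0 \<and> g x = 0"
    and "((\<forall>x. f x \<ge> 0 \<and> g x \<ge> 0) \<and> (\<exists>x. f x \<noteq> 0)) \<or>
         ((\<forall>x. f x \<ge> 0 \<and> g x \<ge> 0) \<and> (\<exists>x. g x \<noteq> 0))"
  shows "\<exists>\<epsilon>\<^sub>0 > 0. \<exists>C > 0. \<forall>\<epsilon> T :: real.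
           0 < \<epsilon> \<and> \<epsilon> \<le> \<epsilon>\<^sub>0 \<and> T > C * \<epsilon> powr (- (p - 1)) \<longrightarrow>
           \<not> (\<exists>v. classical_solution p A (\<lambda>x. \<epsilon> * f x) (\<lambda>x. \<epsilon> * g x) T v)"
proof -
  note p = assms(1) and A = assms(2)
  have \<sigma>: "0 < \<sigma>" using assms(3) by simp
  have nonneg: "0 \<le> f x" "0 \<le> g x" for x using assms(7) by auto
  have f_diff: "(f has_real_derivative deriv f x) (at x)" for x
  proof -
    have "\<forall>j<2. \<forall>x. ((deriv ^^ j) f) differentiable (at x)" using assms(4) by (simp add: C0k_def)
    from this[rule_format, of 0 x] show ?thesis by (simp add: DERIV_deriv_iff_real_differentiable)
  qed
  have f'_cont: "continuous_on UNIV (deriv f)"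
    using assms(4) unfolding C0k_def by (auto dest: spec[of _ "1::nat"])
  have f_cont: "continuous_on UNIV f" and g_cont: "continuous_on UNIV g"
    using assms(4,5) unfolding C0k_def by (auto dest: spec[of _ "0::nat"])
  have outside: "f x = 0" "g x = 0" "deriv f x = 0" if x: "\<bar>x\<bar> > \<sigma>" for x
  proof -
    show "f x = 0" "g x = 0" using assms(6)[of x] x by auto
    have "open {x. \<sigma> < \<bar>x\<bar>}" by (intro open_Collect_less continuous_intros)
    moreover have "\<And>y. y \<in> {x. \<sigma> < \<bar>x\<bar>} \<Longrightarrow> 0 = f y" using assms(6) by force
    ultimately have "(f has_real_derivative 0) (at x)"
      using has_field_derivative_transform_within_open[OF DERIV_const, of "{x. \<sigma> < \<bar>x\<bar>}" x 0 f] x by auto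
    then show "deriv f x = 0" by (rule DERIV_imp_deriv)
  qed
  \<comment> \<open>Continuity includes the end point \<open>- \<sigma>\<close>, where the front
    starts.\<close>
  have left: "f x = 0" "g x = 0" "deriv f x = 0" if "x \<le> - \<sigma>" for x
    using vanishing_from_left[OF f_cont _ that] vanishing_from_left[OF g_cont _ that]
      vanishing_from_left[OF f'_cont _ that] outside \<sigma> by auto
  have right: "g \<sigma> = 0"
    using vanishing_from_right[OF g_cont, of \<sigma> \<sigma>] outside \<sigma> by auto

  \<comment> \<open>This is \<open>functional \<sigma> 0 0\<close> divided by
    \<open>\<epsilon>\<close>: integration by parts turns the weighted mean of
    \<open>deriv f\<close> into the mean of \<open>f\<close>, leaving one of the two copies of
    \<open>f\<close>.\<close>
  define c0 where "c0 = integral {- \<sigma>..\<sigma>} (\<lambda>y. f y + (\<sigma> - y) * g y)"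
  have c0_cont: "continuous_on {- \<sigma>..\<sigma>} (\<lambda>y. f y + (\<sigma> - y) * g y)"
    by (intro continuous_intros continuous_on_subset[OF f_cont] continuous_on_subset[OF g_cont]) auto
  have c0: "0 < c0"
  proof -
    have "0 \<le> c0" unfolding c0_def
      by (intro integral_nonneg integrable_continuous_real c0_cont) (use nonneg in auto)
    moreover have "c0 \<noteq> 0"
    proof
      assume "c0 = 0"
      then have zero: "\<And>y. y \<in> {- \<sigma>..\<sigma>} \<Longrightarrow> f y + (\<sigma> - y) * g y = 0"
        using integral_eq_0_iff[OF c0_cont] \<sigma> nonneg unfolding c0_def by auto
      have "f y = 0 \<and> g y = 0" for y
      \<comment> \<open>The weight \<open>\<sigma> - y\<close> is positive here but vanishes at
        \<open>\<sigma>\<close>, where \<open>right\<close> supplies \<open>g = 0\<close>.\<close>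
      proof (cases "y \<in> {- \<sigma>..<\<sigma>}")
        case True
        then have "0 \<le> (\<sigma> - y) * g y" using nonneg by simp
        then show ?thesis using zero[of y] nonneg(1)[of y] True by (auto simp: add_nonneg_eq_0_iff)
      next
        case False
        then show ?thesis using zero[of \<sigma>] right outside(1,2)[of y] \<sigma> by (cases "y = \<sigma>") auto
      qed
      then show False using assms(7) by auto
    qed
    ultimately show ?thesis by simp
  qed

  \<comment> \<open>The factor \<open>2\<close> anticipates \<open>h_upper\<close>, so that
    \<open>M * \<epsilon>\<close> bounds the initial size of the Riemann invariants.\<close>
  obtain M where M: "0 < M" "\<And>x. \<bar>g x\<bar> + 2 * \<bar>deriv f x\<bar> \<le> M"
  proof -
    have "compact ((\<lambda>x. \<bar>g x\<bar> + 2 * \<bar>deriv f x\<bar>) ` {- \<sigma>..\<sigma>})"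
      by (intro compact_continuous_image continuous_intros continuous_on_subset[OF f'_cont]
        continuous_on_subset[OF g_cont]) auto
    then have "bounded ((\<lambda>x. \<bar>g x\<bar> + 2 * \<bar>deriv f x\<bar>) ` {- \<sigma>..\<sigma>})"
      by (rule compact_imp_bounded)
    then obtain N where N: "0 < N" "\<And>x. x \<in> {- \<sigma>..\<sigma>} \<Longrightarrow> \<bar>\<bar>g x\<bar> + 2 * \<bar>deriv f x\<bar>\<bar> \<le> N"
      unfolding bounded_pos by auto
    have "\<bar>g x\<bar> + 2 * \<bar>deriv f x\<bar> \<le> N" for x
      using N(1) N(2)[of x] outside[of x] by (cases "\<bar>x\<bar> \<le> \<sigma>") (auto simp: abs_le_iff)
    then show ?thesis using that N by blast
  qed
  obtain h where h: "h 0 = 0" "\<And>s. (h has_real_derivative speed p A s) (at s)"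
    using speed_antiderivative[OF p] by metis
  obtain \<eta> where \<eta>: "0 < \<eta>" "\<And>s. \<bar>s\<bar> \<le> \<eta> \<Longrightarrow> speed p A s \<le> 2"
    "\<And>s. \<bar>s\<bar> \<le> \<eta> \<Longrightarrow> (speed p A s)\<^sup>2 = 1 + A * (\<bar>s\<bar> powr (p - 2) * s)"
    using speed_near_zero[OF p, of 2] by (metis one_less_numeral_iff semiring_norm(76))
  have h_upper: "\<bar>h s\<bar> \<le> 2 * \<bar>s\<bar>" if s: "\<bar>s\<bar> \<le> \<eta>" for s
  proof -
    have "norm (h s - h 0) \<le> 2 * norm (s - 0)"
    proof (rule field_differentiable_bound[of "{- \<eta>..\<eta>}"])
      fix r assume "r \<in> {- \<eta>..\<eta>}"
      then show "norm (speed p A r) \<le> 2" using \<eta>(2)[of r] speed_ge_half[of p A r] by auto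
    qed (use s has_field_derivative_at_within[OF h(2)] in auto)
    then show ?thesis using h(1) by simp
  qed

  \<comment> \<open>For \<open>c = \<epsilon> * c0\<close> the \<open>\<mu>\<close> of
    \<open>lifespan_bound\<close> is \<open>\<kappa> * \<epsilon> powr (p - 1)\<close>. Likewise
    \<open>D\<close> is its right-hand side with \<open>B = M\<close> and
    \<open>\<mu> = \<kappa>\<close>.\<close>
  define \<kappa> where "\<kappa> = A / (4 * \<sigma> * p) * (c0 / (16 * \<sigma>\<^sup>2)) powr (p - 1)"
  have \<kappa>: "0 < \<kappa>" using A p \<sigma> c0 by (simp add: \<kappa>_def)
  define D where "D = 4 * \<sigma> * M * (14 * \<sigma> + 8 * \<kappa> * \<sigma>\<^sup>2)"
  have D: "0 < D" using \<kappa> \<sigma> M by (simp add: D_def add_pos_pos)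
  \<comment> \<open>The bound \<open>1\<close> gives \<open>\<epsilon> powr (p - 1) \<le> 1\<close>;
    the other gives \<open>2 * (M * \<epsilon>) \<le> \<eta> / 2\<close>, the smallness needed for
    \<open>slope_bound\<close>.\<close>
  define \<epsilon>0 where "\<epsilon>0 = min 1 (\<eta> / (4 * M))"
  have no_solution: False
    if \<epsilon>: "0 < \<epsilon>" "\<epsilon> \<le> \<epsilon>0" and T: "2 * D / (\<kappa> * c0) * \<epsilon> powr (- (p - 1)) < T"
      and sol: "classical_solution p A (\<lambda>x. \<epsilon> * f x) (\<lambda>x. \<epsilon> * g x) T v" for \<epsilon> T v
  proof -
    have "0 \<le> 2 * D / (\<kappa> * c0) * \<epsilon> powr (- (p - 1))" using D \<kappa> c0 by simp
    then have T0: "0 < T" using T by linarith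
    interpret quasilinear_wave p A T v "dx v" "dt T v" "dx (dx v)" "dt T (dx v)" "dt T (dt T v)"
      by (rule classical_solution_quasilinear_wave[OF p A T0 sol])
    have v0: "v (x, 0) = \<epsilon> * f x" and v1: "dt T v (x, 0) = \<epsilon> * g x" for x
      using sol by (auto simp: classical_solution_def)
    have v0': "dx v (x, 0) = \<epsilon> * deriv f x" for x
      unfolding dx_def using DERIV_cmult[OF f_diff, of \<epsilon> x] by (simp add: v0 DERIV_imp_deriv)
    have \<epsilon>M: "4 * (M * \<epsilon>) \<le> \<eta>" and \<epsilon>1: "\<epsilon> \<le> 1"
      using \<epsilon> M(1) by (auto simp: \<epsilon>0_def field_simps)
    have pos: "0 < M * \<epsilon>" using M \<epsilon> by simp
    have initial: "\<bar>dt T v (x, 0)\<bar> + \<bar>h (dx v (x, 0))\<bar> \<le> M * \<epsilon>" for x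
    proof -
      have "(\<bar>g x\<bar> + 2 * \<bar>deriv f x\<bar>) * \<epsilon> \<le> M * \<epsilon>" using M(2) \<epsilon> by (intro mult_right_mono) auto
      then have *: "\<bar>\<epsilon> * g x\<bar> + 2 * \<bar>\<epsilon> * deriv f x\<bar> \<le> M * \<epsilon>"
        using \<epsilon> by (simp add: abs_mult algebra_simps)
      then have "\<bar>\<epsilon> * deriv f x\<bar> \<le> \<eta>" using \<epsilon>M pos by linarith
      from h_upper[OF this] * show ?thesis by (simp add: v0' v1)
    qed
    have bounds: "\<bar>dt T v z\<bar> \<le> M * \<epsilon>" "\<bar>dx v z\<bar> \<le> 2 * (M * \<epsilon>)" if z: "z \<in> strip T" for z
    proof -
      obtain x t where xt: "z = (x, t)" by force
      have "(x, t) \<in> trapezoid (x - 2 * t) (x + 2 * t) 2 T"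
        using z by (auto simp: trapezoid_def strip_def xt)
      from slope_bound[OF _ \<eta>(2,3) h _ initial this] \<epsilon>M pos
      show "\<bar>dt T v z\<bar> \<le> M * \<epsilon>" "\<bar>dx v z\<bar> \<le> 2 * (M * \<epsilon>)" by (auto simp: xt)
    qed
    have front: "v (- \<sigma> - t, t) = 0 \<and> dx v (- \<sigma> - t, t) = 0 \<and> dt T v (- \<sigma> - t, t) = 0"
      if "t \<in> {0..T}" for t
      using left_front[of \<sigma> t "- \<sigma> - t"] that left by (auto simp: v0 v1 v0')
    have "functional \<sigma> 0 0 = \<epsilon> * c0"
    proof -
      have "((\<lambda>y. (\<sigma> - y) * deriv f y - f y) has_integral ((\<sigma> - \<sigma>) * f \<sigma> - (\<sigma> - - \<sigma>) * f (- \<sigma>))) {- \<sigma>..\<sigma>}"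
      proof (rule fundamental_theorem_of_calculus)
        fix y
        have "((\<lambda>y. (\<sigma> - y) * f y) has_real_derivative (\<sigma> - y) * deriv f y - f y) (at y within {- \<sigma>..\<sigma>})"
          by (auto intro!: derivative_eq_intros has_field_derivative_at_within[OF f_diff])
        then show "((\<lambda>y. (\<sigma> - y) * f y) has_vector_derivative (\<sigma> - y) * deriv f y - f y) (at y within {- \<sigma>..\<sigma>})"
          by (simp add: has_real_derivative_iff_has_vector_derivative)
      qed (use \<sigma> in simp)
      then have parts: "((\<lambda>y. (\<sigma> - y) * deriv f y - f y) has_integral 0) {- \<sigma>..\<sigma>}" using left by simp
      have "((\<lambda>y. f y + (\<sigma> - y) * g y) has_integral c0) {- \<sigma>..\<sigma>}"
        unfolding c0_def by (intro integrable_integral integrable_continuous_real c0_cont)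
      from has_integral_mult_right[OF has_integral_diff[OF this parts], of \<epsilon>]
      have "((\<lambda>y. \<epsilon> * (f y + (\<sigma> - y) * g y - ((\<sigma> - y) * deriv f y - f y))) has_integral \<epsilon> * c0) {- \<sigma>..\<sigma>}"
        by simp
      moreover have "\<epsilon> * (f y + (\<sigma> - y) * g y - ((\<sigma> - y) * deriv f y - f y))
        = (2 + 0 * (\<sigma> - y)) * v (y - 0, 0) + (\<sigma> - y) * (dt T v (y - 0, 0) - dx v (y - 0, 0))" for y
        by (simp add: v0 v1 v0' algebra_simps)
      ultimately show ?thesis unfolding functional_def by (simp only: integral_unique)
    qed
    then have "\<epsilon> * c0 \<le> functional \<sigma> 0 0" by simp
    note estimate = lifespan_bound[OF T0 \<sigma> _ this front bounds]
    define \<delta> where "\<delta> = \<epsilon> powr (p - 1)"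
    have \<delta>: "0 < \<delta>" "\<delta> \<le> 1" using \<epsilon> \<epsilon>1 p by (auto simp: \<delta>_def powr_le1)
    have "(\<epsilon> * c0 / (16 * \<sigma>\<^sup>2)) powr (p - 1) = \<delta> * (c0 / (16 * \<sigma>\<^sup>2)) powr (p - 1)"
      unfolding \<delta>_def using powr_mult[of \<epsilon> "c0 / (16 * \<sigma>\<^sup>2)" "p - 1"] \<epsilon> c0 by simp
    then have \<mu>: "A / (4 * \<sigma> * p) * (\<epsilon> * c0 / (16 * \<sigma>\<^sup>2)) powr (p - 1) = \<kappa> * \<delta>"
      by (simp add: \<kappa>_def)
    \<comment> \<open>Both sides carry a factor \<open>\<epsilon>\<close>. Once
      \<open>\<delta> \<le> 1\<close> is used on the right, cancelling it leaves \<open>T\<close>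
      bounded by a multiple of \<open>1 / \<delta>\<close>.\<close>
    have "\<kappa> * \<delta> * (\<epsilon> * c0) / 2 * T \<le> 4 * \<sigma> * (M * \<epsilon>) * (14 * \<sigma> + 8 * (\<kappa> * \<delta>) * \<sigma>\<^sup>2)"
      using estimate \<epsilon> c0 unfolding \<mu> by simp
    also have "\<dots> \<le> 4 * \<sigma> * (M * \<epsilon>) * (14 * \<sigma> + 8 * (\<kappa> * 1) * \<sigma>\<^sup>2)"
      using \<sigma> pos \<kappa> \<delta> by (intro mult_left_mono mult_right_mono add_left_mono) auto
    also have "\<dots> = D * \<epsilon>" by (simp add: D_def)
    finally have upper: "\<kappa> * \<delta> * c0 * T \<le> 2 * D" using \<epsilon> by (simp add: field_simps)
    have inverse: "\<epsilon> powr (- (p - 1)) = 1 / \<delta>" unfolding \<delta>_def by (rule powr_minus_divide)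
    have "2 * D / (\<kappa> * c0) * \<epsilon> powr (- (p - 1)) = 2 * D / (\<kappa> * \<delta> * c0)"
      unfolding inverse by (simp add: mult_ac)
    then have "2 * D / (\<kappa> * \<delta> * c0) < T" using T by linarith
    moreover have "0 < \<kappa> * \<delta> * c0" using \<kappa> \<delta> c0 by simp
    ultimately have "2 * D < \<kappa> * \<delta> * c0 * T" by (simp only: pos_divide_less_eq mult.commute[of T])
    then show False using upper by linarith
  qed
  have "0 < \<epsilon>0" using \<eta>(1) M(1) by (simp add: \<epsilon>0_def)
  moreover have "0 < 2 * D / (\<kappa> * c0)" using D \<kappa> c0 by simp
  moreover have "\<forall>\<epsilon> T. 0 < \<epsilon> \<and> \<epsilon> \<le> \<epsilon>0 \<and> T > 2 * D / (\<kappa> * c0) * \<epsilon> powr (- (p - 1)) \<longrightarrow>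
      \<not> (\<exists>v. classical_solution p A (\<lambda>x. \<epsilon> * f x) (\<lambda>x. \<epsilon> * g x) T v)"
    by (intro allI impI notI, elim conjE exE, rule no_solution)
  ultimately show ?thesis by (intro exI conjI)
qed

end
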